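(* Let $O$ be a unique sink orientation of $Q_n$ and let $H\subseteq E(Q_n)$ be a matching (a set of pairwise vertex-disjoint edges, possibly of different dimensions). Then $O\otimes H$ is a unique sink orientation if and only if $H$ is a union of phases of $O$.
   Context: The $n$-cube $Q_n$ is the graph on $\{0,1\}^n$ where two vertices are adjacent iff they differ in exactly one coordinate; an edge whose endpoints differ in coordinate $i$ is an $i$-edge, and $E_i$ is the set of $i$-edges. A face of $Q_n$ is given by a string $f\in\{0,1,*\}^n$ and is the induced subgraph on all $v$ with $v_i=f_i$ or $f_i=*$ for every $i$. An orientation is a function $O:\{0,1\}^n\to\{0,1\}^n$ (outmap) such that $O(v)_i\ne O(v')_i$ whenever $v,v'$ differ exactly in coordinate $i$; $O(v)_i=1$ means the $i$-edge at $v$ is outgoing from $v$, and $O(v)_i=0$ means it is incoming. $O$ is a unique sink orientation (USO) if every face contains exactly one vertex with no outgoing edges inside the face. For a set $S$ of edges, $O\otimes S$ denotes the orientation obtained from $O$ by reversing exactly the edges in $S$. Phases: let $O$ be a USO. Two $i$-edges $e,e'\in E_i$ are in direct phase if there exist $v\in e$, $w\in e'$ such that $O(v)_j=O(w)_j$ for all $j\neq i$ with $v_j\ne w_j$. Two $i$-edges are in phase if they are linked by a finite sequence of $i$-edges in which consecutive edges are in direct phase. An $i$-phase is an equivalence class of $E_i$ under this relation; a phase is an $i$-phase for some $i\in[n]$. A union of phases may be empty and may involve phases of several dimensions. *)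

theory Defs
  imports Main
begin

text \<open>A vertex of the cube is a 0/1 string, written as a list of Booleans with True for 1;
  coordinates are numbered from 0 to n - 1.\<close>

definition vertices :: "nat \<Rightarrow> bool list set" where
  "vertices n = {v. length v = n}"

definition i_adjacent :: "nat \<Rightarrow> nat \<Rightarrow> bool list \<Rightarrow> bool list \<Rightarrow> bool" where
  "i_adjacent n i v w \<longleftrightarrow>
     i < n \<and> v \<in> vertices n \<and> w \<in> vertices n \<and> (\<forall>j<n. v ! j \<noteq> w ! j \<longleftrightarrow> j = i)"

definition i_edges :: "nat \<Rightarrow> nat \<Rightarrow> bool list set set" where
  "i_edges n i = {{v, w} | v w. i_adjacent n i v w}"

definition cube_edges :: "nat \<Rightarrow> bool list set set" where
  "cube_edges n = (\<Union>i<n. i_edges n i)"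

definition matching :: "nat \<Rightarrow> bool list set set \<Rightarrow> bool" where
  "matching n H \<longleftrightarrow> H \<subseteq> cube_edges n \<and> pairwise disjnt H"

text \<open>In a face string, None stands for the symbol *.\<close>

definition face_strings :: "nat \<Rightarrow> bool option list set" where
  "face_strings n = {f. length f = n}"

definition face :: "nat \<Rightarrow> bool option list \<Rightarrow> bool list set" where
  "face n f = {v \<in> vertices n. \<forall>i<n. f ! i = Some (v ! i) \<or> f ! i = None}"

text \<open>Outmaps are total functions on lists, but only their values on vertices matter.\<close>

definition orientation :: "nat \<Rightarrow> (bool list \<Rightarrow> bool list) \<Rightarrow> bool" where
  "orientation n \<phi> \<longleftrightarrow>
     (\<forall>v \<in> vertices n. \<phi> v \<in> vertices n) \<and>
     (\<forall>i v w. i_adjacent n i v w \<longrightarrow> \<phi> v ! i \<noteq> \<phi> w ! i)"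

definition sink_in :: "nat \<Rightarrow> (bool list \<Rightarrow> bool list) \<Rightarrow> bool list set \<Rightarrow> bool list \<Rightarrow> bool" where
  "sink_in n \<phi> F v \<longleftrightarrow> v \<in> F \<and> \<not> (\<exists>i. \<exists>w\<in>F. i_adjacent n i v w \<and> \<phi> v ! i)"

definition uso :: "nat \<Rightarrow> (bool list \<Rightarrow> bool list) \<Rightarrow> bool" where
  "uso n \<phi> \<longleftrightarrow> orientation n \<phi> \<and> (\<forall>f \<in> face_strings n. \<exists>!v. sink_in n \<phi> (face n f) v)"

definition flip :: "nat \<Rightarrow> bool list \<Rightarrow> bool list" where
  "flip i v = v[i := \<not> v ! i]"

definition reverse_edges ::
  "nat \<Rightarrow> (bool list \<Rightarrow> bool list) \<Rightarrow> bool list set set \<Rightarrow> bool list \<Rightarrow> bool list" where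
  "reverse_edges n \<phi> S v =
     map (\<lambda>i. if {v, flip i v} \<in> S then \<not> \<phi> v ! i else \<phi> v ! i) [0..<n]"

definition direct_phase ::
  "nat \<Rightarrow> (bool list \<Rightarrow> bool list) \<Rightarrow> nat \<Rightarrow> bool list set rel" where
  "direct_phase n \<phi> i = {(e, e'). e \<in> i_edges n i \<and> e' \<in> i_edges n i \<and>
     (\<exists>v\<in>e. \<exists>w\<in>e'. \<forall>j<n. j \<noteq> i \<and> v ! j \<noteq> w ! j \<longrightarrow> \<phi> v ! j = \<phi> w ! j)}"

text \<open>Being in direct phase is reflexive on the i-edges, so the transitive closure already contains
  the sequences of length zero.\<close>

definition in_phase ::
  "nat \<Rightarrow> (bool list \<Rightarrow> bool list) \<Rightarrow> nat \<Rightarrow> bool list set rel" where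
  "in_phase n \<phi> i = (direct_phase n \<phi> i)\<^sup>+"

definition phases :: "nat \<Rightarrow> (bool list \<Rightarrow> bool list) \<Rightarrow> bool list set set set" where
  "phases n \<phi> = (\<Union>i<n. i_edges n i // in_phase n \<phi> i)"

lemma equiv_in_phase: "equiv (i_edges n i) (in_phase n \<phi> i)"
proof (rule equivI)
  have sub: "direct_phase n \<phi> i \<subseteq> i_edges n i \<times> i_edges n i"
    by (auto simp: direct_phase_def)
  show "in_phase n \<phi> i \<subseteq> i_edges n i \<times> i_edges n i"
    unfolding in_phase_def using sub by (rule trancl_subset_Sigma)
  have "(e, e) \<in> direct_phase n \<phi> i" if "e \<in> i_edges n i" for e
    using that by (auto simp: direct_phase_def i_edges_def)
  then show "refl_on (i_edges n i) (in_phase n \<phi> i)"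
    unfolding refl_on_def in_phase_def by blast
  have "sym (direct_phase n \<phi> i)"
    unfolding sym_def direct_phase_def by clarsimp metis
  then show "sym (in_phase n \<phi> i)"
    unfolding in_phase_def by (rule sym_trancl)
  show "trans (in_phase n \<phi> i)"
    unfolding in_phase_def by (rule trans_trancl)
qed

lemma i_adjacent_iff_flip:
  "i_adjacent n i v w \<longleftrightarrow> i < n \<and> v \<in> vertices n \<and> w = flip i v"
  by (auto simp: i_adjacent_def vertices_def flip_def nth_list_update split: if_splits intro!: nth_equalityI)

lemma orientation_reverse_edges:
  assumes "orientation n \<phi>"
  shows "orientation n (reverse_edges n \<phi> S)"
proof -
  have "reverse_edges n \<phi> S v ! i \<noteq> reverse_edges n \<phi> S w ! i" if "i_adjacent n i v w" for i v w
  proof -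
    have i: "i < n" "w = flip i v" "v = flip i w"
      using that by (auto simp: i_adjacent_iff_flip vertices_def flip_def)
    have "{v, flip i v} = {w, flip i w}"
      using i by auto
    moreover have "\<phi> v ! i \<noteq> \<phi> w ! i"
      using assms that by (auto simp: orientation_def)
    ultimately show ?thesis
      using \<open>i < n\<close> by (simp add: reverse_edges_def)
  qed
  then show ?thesis
    by (auto simp: orientation_def reverse_edges_def vertices_def)
qed

end

theory Submission
  imports Defs
begin

text \<open>By the Szabo--Welzl criterion, an orientation is a USO iff any two distinct vertices have
  different outmap values in some coordinate in which they differ; equivalently, on every face the
  outmap is a bijection onto the patterns of that face. Since \<^term>\<open>H\<close> is a matching, the
  outmap of every vertex changes in at most one coordinate, and both directions reduce to showing
  that \<^term>\<open>H\<close> is closed under being in direct phase.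

  If \<^term>\<open>H\<close> is closed and the reversed outmap fails to separate \<^term>\<open>v\<close> and \<^term>\<open>w\<close>, then
  on the face that they span the original outmaps differ exactly in two coordinates a and b, where
  the a-edge of v and the b-edge of w are in \<^term>\<open>H\<close>. The vertex of that face whose pattern is
  obtained from that of v by changing only the coordinate a is then in direct phase with v in
  dimension a and with w in dimension b, so two edges of \<^term>\<open>H\<close> meet there.

  Conversely, closedness is shown by induction on the dimension of the face spanned by v and w.
  If the i-edge of v is in \<^term>\<open>H\<close> but that of w is not, then some b-edge of w is. The vertex u
  whose original pattern is the reversed pattern of w is not antipodal to w, so by
  induction its b-edge is in \<^term>\<open>H\<close>, and u and v have the same reversed pattern.\<close>

section \<open>Faces as subcubes, and the separation condition\<close>

definition subcube :: "nat \<Rightarrow> bool list \<Rightarrow> nat set \<Rightarrow> bool list set" where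
  "subcube n v D = {u \<in> vertices n. \<forall>j<n. j \<notin> D \<longrightarrow> u ! j = v ! j}"

text \<open>The Szabo--Welzl condition in contrapositive form: outmaps that agree wherever the
  vertices differ force the vertices to be equal.\<close>

definition separating :: "nat \<Rightarrow> (bool list \<Rightarrow> bool list) \<Rightarrow> bool" where
  "separating n \<phi> \<longleftrightarrow> (\<forall>v\<in>vertices n. \<forall>w\<in>vertices n.
     (\<forall>j<n. v ! j \<noteq> w ! j \<longrightarrow> \<phi> v ! j = \<phi> w ! j) \<longrightarrow> v = w)"

lemma separatingD:
  assumes "separating n \<phi>" "v \<in> vertices n" "w \<in> vertices n"
    and "\<And>j. j < n \<Longrightarrow> v ! j \<noteq> w ! j \<Longrightarrow> \<phi> v ! j = \<phi> w ! j"
  shows "v = w"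
  using assms unfolding separating_def by blast

lemma vertices_eqI:
  "v \<in> vertices n \<Longrightarrow> w \<in> vertices n \<Longrightarrow> (\<And>j. j < n \<Longrightarrow> v ! j = w ! j) \<Longrightarrow> v = w"
  by (auto simp: vertices_def intro: nth_equalityI)

lemma flip_in_vertices [simp]: "flip i v \<in> vertices n \<longleftrightarrow> v \<in> vertices n"
  by (simp add: vertices_def flip_def)

lemma nth_flip:
  "v \<in> vertices n \<Longrightarrow> j < n \<Longrightarrow> flip i v ! j \<longleftrightarrow> (if j = i then \<not> v ! j else v ! j)"
  by (simp add: vertices_def flip_def nth_list_update)

lemma flip_flip [simp]: "flip i (flip i v) = v"
  by (cases "i < length v") (simp_all add: flip_def list_update_beyond)

text \<open>The base point carries False at the free coordinates; the choice is arbitrary because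
  \<open>subcube\<close> ignores its base point there.\<close>

lemma face_eq_subcube:
  assumes "f \<in> face_strings n"
  shows "face n f = subcube n (map (\<lambda>x. x = Some True) f) {j. j < n \<and> f ! j = None}"
proof -
  have "(f ! i = Some b \<or> f ! i = None) \<longleftrightarrow> (f ! i \<noteq> None \<longrightarrow> b = (f ! i = Some True))" for i b
    by (cases "f ! i") auto
  then show ?thesis
    using assms by (auto simp: face_def subcube_def face_strings_def)
qed

lemma subcube_eq_face:
  "subcube n v D = face n (map (\<lambda>j. if j \<in> D then None else Some (v ! j)) [0..<n])"
  by (auto simp: face_def subcube_def)

lemma sink_in_subcube:
  assumes "D \<subseteq> {..<n}"
  shows "sink_in n \<phi> (subcube n v D) u \<longleftrightarrow> u \<in> subcube n v D \<and> (\<forall>j\<in>D. \<not> \<phi> u ! j)"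
proof -
  have "flip i u \<in> subcube n v D \<longleftrightarrow> i \<in> D" if "u \<in> subcube n v D" "i < n" for i
    using that assms by (auto simp: subcube_def nth_flip split: if_splits)
  then show ?thesis
    using assms unfolding sink_in_def i_adjacent_iff_flip subcube_def by blast
qed

lemma uso_iff_subcube:
  "uso n \<phi> \<longleftrightarrow> orientation n \<phi> \<and>
     (\<forall>v\<in>vertices n. \<forall>D\<subseteq>{..<n}. \<exists>!u. u \<in> subcube n v D \<and> (\<forall>j\<in>D. \<not> \<phi> u ! j))"
  (is "_ \<longleftrightarrow> _ \<and> ?R")
proof -
  have "(\<forall>f\<in>face_strings n. \<exists>!v. sink_in n \<phi> (face n f) v) \<longleftrightarrow> ?R"
  proof (intro iffI ballI allI impI)
    fix v D
    assume *: "\<forall>f\<in>face_strings n. \<exists>!v. sink_in n \<phi> (face n f) v" and D: "D \<subseteq> {..<n}"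
    have "\<exists>!u. sink_in n \<phi> (subcube n v D) u"
      unfolding subcube_eq_face using * by (simp add: face_strings_def)
    then show "\<exists>!u. u \<in> subcube n v D \<and> (\<forall>j\<in>D. \<not> \<phi> u ! j)"
      by (simp add: sink_in_subcube[OF D])
  next
    fix f
    assume R: ?R and f: "f \<in> face_strings n"
    let ?v = "map (\<lambda>x. x = Some True) f" and ?D = "{j. j < n \<and> f ! j = None}"
    have D: "?D \<subseteq> {..<n}" by auto
    have "?v \<in> vertices n" using f by (simp add: vertices_def face_strings_def)
    then show "\<exists>!v. sink_in n \<phi> (face n f) v"
      unfolding face_eq_subcube[OF f] sink_in_subcube[OF D] using R D by blast
  qed
  then show ?thesis by (simp add: uso_def)
qed

section \<open>The Szabo--Welzl criterion\<close>

lemma bij_betw_subcube_Pow: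
  assumes "v \<in> vertices n" "D \<subseteq> {..<n}"
  shows "bij_betw (\<lambda>u. {j \<in> D. u ! j}) (subcube n v D) (Pow D)"
proof (intro bij_betw_imageI inj_onI equalityI subsetI)
  fix u w
  assume "u \<in> subcube n v D" "w \<in> subcube n v D" "{j \<in> D. u ! j} = {j \<in> D. w ! j}"
  then show "u = w"
    by (intro vertices_eqI[of _ n]) (auto simp: subcube_def)
next
  fix A
  assume "A \<in> Pow D"
  then have "A = {j \<in> D. map (\<lambda>j. if j \<in> D then j \<in> A else v ! j) [0..<n] ! j}"
    using assms(2) by (auto simp: subset_iff)
  moreover have "map (\<lambda>j. if j \<in> D then j \<in> A else v ! j) [0..<n] \<in> subcube n v D"
    by (auto simp: subcube_def vertices_def)
  ultimately show "A \<in> (\<lambda>u. {j \<in> D. u ! j}) ` subcube n v D" by blast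
qed auto

text \<open>Vertices of one face differ only inside \<open>D\<close>, so separation makes the
  pattern map injective. A face has as many vertices as \<open>D\<close> has subsets, hence every
  pattern \<open>P\<close> occurs.\<close>

lemma separating_surj:
  assumes sep: "separating n \<phi>" and v: "v \<in> vertices n" and D: "D \<subseteq> {..<n}"
  obtains u where "u \<in> subcube n v D" "\<And>j. j \<in> D \<Longrightarrow> \<phi> u ! j \<longleftrightarrow> P j"
proof -
  let ?g = "\<lambda>u. {j \<in> D. \<phi> u ! j}"
  have fin: "finite (Pow D)" using D by (simp add: finite_subset)
  have inj: "inj_on ?g (subcube n v D)"
  proof (rule inj_onI)
    fix u w
    assume *: "u \<in> subcube n v D" "w \<in> subcube n v D" and "?g u = ?g w"
    then have "\<phi> u ! j = \<phi> w ! j" if "j \<in> D" for j using that by blast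
    then show "u = w"
      using * by (intro separatingD[OF sep]) (auto simp: subcube_def)
  qed
  have "card (?g ` subcube n v D) = card (Pow D)"
    using card_image[OF inj] bij_betw_same_card[OF bij_betw_subcube_Pow[OF v D]] by simp
  then have "?g ` subcube n v D = Pow D"
    by (intro card_subset_eq[OF fin]) auto
  then have "{j \<in> D. P j} \<in> ?g ` subcube n v D" by auto
  then show thesis using that by blast
qed

text \<open>Unique sinks are the case of an empty \<open>A\<close>. Adding \<open>a\<close> to
  \<open>A\<close> amounts to passing to the facet, in direction \<open>a\<close>, opposite to the
  vertex \<open>s\<close> with the old pattern.\<close>

lemma uso_pattern:
  assumes "uso n \<phi>" "finite A" "v \<in> vertices n" "D \<subseteq> {..<n}"
  shows "\<exists>!u. u \<in> subcube n v D \<and> (\<forall>j\<in>D. \<phi> u ! j \<longleftrightarrow> j \<in> A)"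
  using assms(2-)
proof (induction A arbitrary: v D rule: finite_induct)
  case empty
  then show ?case using assms(1) by (simp add: uso_iff_subcube)
next
  case (insert a A)
  show ?case
  proof (cases "a \<in> D")
    case False
    then have "(\<forall>j\<in>D. \<phi> u ! j \<longleftrightarrow> j \<in> insert a A) \<longleftrightarrow> (\<forall>j\<in>D. \<phi> u ! j \<longleftrightarrow> j \<in> A)" for u
      by auto
    then show ?thesis using insert.IH[OF insert.prems] by simp
  next
    case True
    then have a: "a < n" using insert.prems by auto
    let ?D = "D - {a}"
    have D': "?D \<subseteq> {..<n}" using insert.prems by auto
    obtain s where s: "s \<in> subcube n v D" "\<forall>j\<in>D. \<phi> s ! j \<longleftrightarrow> j \<in> A"
      and s_unique: "\<And>u. u \<in> subcube n v D \<Longrightarrow> \<forall>j\<in>D. \<phi> u ! j \<longleftrightarrow> j \<in> A \<Longrightarrow> u = s"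
      using insert.IH[OF insert.prems] by blast
    have sv: "s \<in> vertices n" using s by (simp add: subcube_def)
    then have fv: "flip a s \<in> vertices n" by simp
    obtain t where t: "t \<in> subcube n (flip a s) ?D" "\<forall>j\<in>?D. \<phi> t ! j \<longleftrightarrow> j \<in> A"
      and t_unique: "\<And>u. u \<in> subcube n (flip a s) ?D \<Longrightarrow> \<forall>j\<in>?D. \<phi> u ! j \<longleftrightarrow> j \<in> A \<Longrightarrow> u = t"
      using insert.IH[OF fv D'] by blast
    have t_D: "t \<in> subcube n v D"
      using t(1) s(1) True sv by (auto simp: subcube_def nth_flip)
    have "t ! a \<noteq> s ! a" using t(1) a sv by (simp add: subcube_def nth_flip)
    \<comment> \<open>Otherwise \<open>t\<close> would have the old pattern on all of
      \<open>D\<close> and equal \<open>s\<close>, from which it differs in coordinate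
      \<open>a\<close>.\<close>
    then have "\<phi> t ! a" using s_unique[OF t_D] t(2) insert.hyps by blast
    then have t_pat: "\<forall>j\<in>D. \<phi> t ! j \<longleftrightarrow> j \<in> insert a A" using t(2) by blast
    have "u = t" if u: "u \<in> subcube n v D" "\<forall>j\<in>D. \<phi> u ! j \<longleftrightarrow> j \<in> insert a A" for u
    proof (cases "u ! a = s ! a")
      case True
      have "u \<in> subcube n s ?D" "s \<in> subcube n s ?D"
        using u(1) s(1) True by (auto simp: subcube_def)
      moreover have "\<forall>j\<in>?D. \<phi> u ! j \<longleftrightarrow> j \<in> A" "\<forall>j\<in>?D. \<phi> s ! j \<longleftrightarrow> j \<in> A"
        using u(2) s(2) by auto
      \<comment> \<open>Within the facet of \<open>s\<close> the pattern on \<open>D - {a}\<close>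
        already determines the vertex, but \<open>u\<close> and \<open>s\<close> have different
        outmaps at \<open>a\<close>.\<close>
      ultimately have "u = s" using insert.IH[OF sv D'] by blast
      then show ?thesis using u(2) s(2) \<open>a \<in> D\<close> insert.hyps by blast
    next
      case False
      have "u \<in> subcube n (flip a s) ?D"
        using u(1) s(1) False sv by (auto simp: subcube_def nth_flip)
      then show ?thesis using u(2) by (intro t_unique) auto
    qed
    then show ?thesis using t_D t_pat by blast
  qed
qed

text \<open>Forward, \<open>v\<close> and \<open>w\<close> share a pattern on the face they span,
  where patterns are unique. Backward, the sink is the vertex with the all-False pattern.\<close>

lemma uso_iff_separating: "uso n \<phi> \<longleftrightarrow> orientation n \<phi> \<and> separating n \<phi>"
proof
  assume uso: "uso n \<phi>"
  have "v = w" if v: "v \<in> vertices n" and w: "w \<in> vertices n"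
    and agree: "\<forall>j<n. v ! j \<noteq> w ! j \<longrightarrow> \<phi> v ! j = \<phi> w ! j" for v w
  proof -
    let ?D = "{j. j < n \<and> v ! j \<noteq> w ! j}"
    have "\<exists>!u. u \<in> subcube n v ?D \<and> (\<forall>j\<in>?D. \<phi> u ! j \<longleftrightarrow> j \<in> {j \<in> ?D. \<phi> v ! j})"
      by (rule uso_pattern[OF uso _ v]) auto
    moreover have "v \<in> subcube n v ?D" "w \<in> subcube n v ?D"
      using v w by (auto simp: subcube_def)
    ultimately show ?thesis using agree by blast
  qed
  then show "orientation n \<phi> \<and> separating n \<phi>"
    using uso unfolding separating_def uso_def by blast
next
  assume *: "orientation n \<phi> \<and> separating n \<phi>"
  have "\<exists>!u. u \<in> subcube n v D \<and> (\<forall>j\<in>D. \<not> \<phi> u ! j)"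
    if v: "v \<in> vertices n" and D: "D \<subseteq> {..<n}" for v D
  proof -
    obtain u where u: "u \<in> subcube n v D" "\<And>j. j \<in> D \<Longrightarrow> \<phi> u ! j \<longleftrightarrow> False"
      using separating_surj[OF conjunct2[OF *] v D, of "\<lambda>_. False"] by blast
    have "w = u" if "w \<in> subcube n v D" "\<forall>j\<in>D. \<not> \<phi> w ! j" for w
      using that u by (intro separatingD[OF conjunct2[OF *]]) (auto simp: subcube_def)
    then show ?thesis using u by blast
  qed
  then show "uso n \<phi>" using * by (simp add: uso_iff_subcube)
qed

section \<open>Edges, matchings and unions of phases\<close>

lemma i_edges_eq: "i_edges n i = {{v, flip i v} | v. i < n \<and> v \<in> vertices n}"
  by (auto simp: i_edges_def i_adjacent_iff_flip)

lemma flip_pair_in_i_edges: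
  "i < n \<Longrightarrow> v \<in> vertices n \<Longrightarrow> {v, flip i v} \<in> i_edges n i"
  by (auto simp: i_edges_eq)

lemma i_edge_eq_flip_pair:
  "e \<in> i_edges n i \<Longrightarrow> v \<in> e \<Longrightarrow> i < n \<and> v \<in> vertices n \<and> e = {v, flip i v}"
  by (auto simp: i_edges_eq)

lemma flip_inject:
  assumes "flip i v = flip j v" "i < n" "v \<in> vertices n"
  shows "i = j"
  using assms nth_flip[of v n i i] nth_flip[of v n i j] by (metis (full_types))

lemma i_edges_disjoint:
  assumes "e \<in> i_edges n i" "e \<in> i_edges n j"
  shows "i = j"
proof -
  obtain v where v: "v \<in> e" "i < n" "v \<in> vertices n" "e = {v, flip i v}"
    using assms(1) by (auto simp: i_edges_eq)
  have "{v, flip i v} = {v, flip j v}"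
    using i_edge_eq_flip_pair[OF assms(2)] v by simp
  then have "flip i v = flip j v" by (auto simp: doubleton_eq_iff)
  then show ?thesis using v(2,3) by (rule flip_inject)
qed

lemma matching_unique:
  assumes "matching n H" "v \<in> vertices n" "i < n"
    and "{v, flip i v} \<in> H" "{v, flip j v} \<in> H"
  shows "i = j"
proof -
  have "{v, flip i v} = {v, flip j v}"
    using assms(1) pairwiseD[of disjnt H, OF _ assms(4,5)] by (auto simp: matching_def disjnt_def)
  then have "flip i v = flip j v" by (auto simp: doubleton_eq_iff)
  then show ?thesis using assms(3,2) by (rule flip_inject)
qed

lemma nth_reverse_edges:
  "j < n \<Longrightarrow> reverse_edges n \<phi> H v ! j \<longleftrightarrow> (\<phi> v ! j \<noteq> ({v, flip j v} \<in> H))"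
  by (simp add: reverse_edges_def)

text \<open>Closure of \<open>H\<close> under direct phase, expressed through endpoints:
  \<open>v\<close> and \<open>w\<close> are the witnesses on the two \<open>i\<close>-edges.\<close>

definition phase_closed :: "nat \<Rightarrow> (bool list \<Rightarrow> bool list) \<Rightarrow> bool list set set \<Rightarrow> bool" where
  "phase_closed n \<phi> H \<longleftrightarrow> (\<forall>i<n. \<forall>v\<in>vertices n. \<forall>w\<in>vertices n.
     (\<forall>j<n. j \<noteq> i \<and> v ! j \<noteq> w ! j \<longrightarrow> \<phi> v ! j = \<phi> w ! j) \<longrightarrow>
     {v, flip i v} \<in> H \<longrightarrow> {w, flip i w} \<in> H)"

lemma phase_closedD:
  assumes "phase_closed n \<phi> H" "i < n" "v \<in> vertices n" "w \<in> vertices n"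
    and "\<And>j. j < n \<Longrightarrow> j \<noteq> i \<Longrightarrow> v ! j \<noteq> w ! j \<Longrightarrow> \<phi> v ! j = \<phi> w ! j"
    and "{v, flip i v} \<in> H"
  shows "{w, flip i w} \<in> H"
  using assms unfolding phase_closed_def by blast

text \<open>Phases are the classes of the equivalence generated by direct phase, so closure under
  single steps already makes \<open>H\<close> a union of classes.\<close>

lemma union_of_phases_iff_phase_closed:
  assumes "H \<subseteq> cube_edges n"
  shows "(\<exists>\<P>\<subseteq>phases n \<phi>. H = \<Union>\<P>) \<longleftrightarrow> phase_closed n \<phi> H"
proof
  assume "\<exists>\<P>\<subseteq>phases n \<phi>. H = \<Union>\<P>"
  then obtain \<P> where P: "\<P> \<subseteq> phases n \<phi>" "H = \<Union>\<P>" by blast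
  have "{w, flip i w} \<in> H"
    if i: "i < n" and v: "v \<in> vertices n" and w: "w \<in> vertices n"
      and agree: "\<forall>j<n. j \<noteq> i \<and> v ! j \<noteq> w ! j \<longrightarrow> \<phi> v ! j = \<phi> w ! j"
      and vH: "{v, flip i v} \<in> H" for i v w
  proof -
    obtain X k where X: "X \<in> \<P>" "{v, flip i v} \<in> X" "X \<in> i_edges n k // in_phase n \<phi> k"
      using P vH unfolding phases_def by blast
    have "{v, flip i v} \<in> i_edges n k"
      using in_quotient_imp_subset[OF equiv_in_phase X(3)] X(2) by blast
    \<comment> \<open>An edge determines its dimension, so the phase \<open>X\<close> is an
      \<open>i\<close>-phase.\<close>
    then have k: "k = i"
      using i_edges_disjoint flip_pair_in_i_edges[OF i v] by blast
    have "({v, flip i v}, {w, flip i w}) \<in> direct_phase n \<phi> i"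
      unfolding direct_phase_def using flip_pair_in_i_edges i v w agree by blast
    then have "({v, flip i v}, {w, flip i w}) \<in> in_phase n \<phi> i"
      unfolding in_phase_def by blast
    then have "{w, flip i w} \<in> X"
      using in_quotient_imp_closed[OF equiv_in_phase X(3)] X(2) k by blast
    then show ?thesis using X(1) P(2) by blast
  qed
  then show "phase_closed n \<phi> H" unfolding phase_closed_def by blast
next
  assume cl: "phase_closed n \<phi> H"
  have dp: "e' \<in> H" if dir: "(e, e') \<in> direct_phase n \<phi> i" and eH: "e \<in> H" for e e' i
  proof -
    obtain v w where *: "v \<in> e" "w \<in> e'" "e \<in> i_edges n i" "e' \<in> i_edges n i"
      and agree: "\<forall>j<n. j \<noteq> i \<and> v ! j \<noteq> w ! j \<longrightarrow> \<phi> v ! j = \<phi> w ! j"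
      using dir unfolding direct_phase_def by blast
    show ?thesis
      using phase_closedD[OF cl, of i v w] i_edge_eq_flip_pair[OF *(3,1)]
        i_edge_eq_flip_pair[OF *(4,2)] agree eH by simp
  qed
  have ph: "e' \<in> H" if "(e, e') \<in> in_phase n \<phi> i" "e \<in> H" for e e' i
    using that unfolding in_phase_def by (induction rule: trancl_induct) (auto intro: dp)
  let ?P = "{in_phase n \<phi> i `` {e} | i e. i < n \<and> e \<in> i_edges n i \<and> e \<in> H}"
  have "?P \<subseteq> phases n \<phi>" unfolding phases_def by (blast intro: quotientI)
  moreover have "\<Union>?P \<subseteq> H" using ph by blast
  moreover have "H \<subseteq> \<Union>?P"
  proof
    fix e
    assume e: "e \<in> H"
    then obtain i where i: "i < n" "e \<in> i_edges n i"
      using assms unfolding cube_edges_def by blast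
    have "e \<in> in_phase n \<phi> i `` {e}" by (rule equiv_class_self[OF equiv_in_phase i(2)])
    then show "e \<in> \<Union>?P" using i e by blast
  qed
  ultimately show "\<exists>\<P>\<subseteq>phases n \<phi>. H = \<Union>\<P>" by blast
qed

section \<open>Separation after reversal versus closure under phases\<close>

lemma separating_reverse_edges:
  assumes sep: "separating n \<phi>" and M: "matching n H" and cl: "phase_closed n \<phi> H"
  shows "separating n (reverse_edges n \<phi> H)"
proof -
  define h where "h v j \<longleftrightarrow> {v, flip j v} \<in> H" for v j
  have h_unique: "i = j" if "h v i" "h v j" "v \<in> vertices n" "i < n" for v i j
    using that matching_unique[OF M] by (auto simp: h_def)
  \<comment> \<open>If membership in \<open>H\<close> agrees on all differing coordinates, equal
    reversed patterns give equal original patterns, and \<open>sep\<close> applies.\<close>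
  have h_agree: "h v a \<longleftrightarrow> h w a"
    if v: "v \<in> vertices n" and w: "w \<in> vertices n" and a: "a < n" "v ! a \<noteq> w ! a"
      and agree: "\<And>j. j < n \<Longrightarrow> v ! j \<noteq> w ! j \<Longrightarrow> (\<phi> v ! j \<noteq> h v j) = (\<phi> w ! j \<noteq> h w j)"
    for v w a
  proof -
    have "h w a"
      if v: "v \<in> vertices n" and w: "w \<in> vertices n" and a: "a < n" "v ! a \<noteq> w ! a"
        and agree: "\<And>j. j < n \<Longrightarrow> v ! j \<noteq> w ! j \<Longrightarrow> (\<phi> v ! j \<noteq> h v j) = (\<phi> w ! j \<noteq> h w j)"
        and hv: "h v a" for v w
    proof (rule ccontr)
      assume hw: "\<not> h w a"
      \<comment> \<open>Without such a \<open>b\<close> the \<open>a\<close>-edges of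
        \<open>v\<close> and \<open>w\<close> would be in direct phase.\<close>
      obtain b where b: "b < n" "b \<noteq> a" "v ! b \<noteq> w ! b" "\<phi> v ! b \<noteq> \<phi> w ! b"
        using phase_closedD[OF cl a(1) v w] hv hw unfolding h_def by blast
      have "\<not> h v b" using h_unique[OF hv _ v a(1)] b(2) by blast
      then have hb: "h w b" using agree[OF b(1,3)] b(4) by blast
      let ?D = "{j. j < n \<and> v ! j \<noteq> w ! j}"
      obtain u where u: "u \<in> subcube n v ?D"
        and pat: "\<And>j. j \<in> ?D \<Longrightarrow> \<phi> u ! j \<longleftrightarrow> (if j = a then \<phi> w ! j else \<phi> v ! j)"
        using separating_surj[OF sep v, of ?D "\<lambda>j. if j = a then \<phi> w ! j else \<phi> v ! j"] by blast
      have uv: "u \<in> vertices n" using u by (simp add: subcube_def)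
      have in_D: "v ! j \<noteq> w ! j" if "j < n" "v ! j \<noteq> u ! j \<or> w ! j \<noteq> u ! j" for j
        using u that by (auto simp: subcube_def)
      \<comment> \<open>The matching property lets \<open>H\<close> alter \<open>v\<close> only at
        \<open>a\<close> and \<open>w\<close> only at \<open>b\<close>.\<close>
      have other: "\<phi> v ! j = \<phi> w ! j" if "j < n" "v ! j \<noteq> w ! j" "j \<noteq> a" "j \<noteq> b" for j
        using agree[OF that(1,2)] h_unique[OF hv _ v a(1)] h_unique[OF hb _ w b(1)] that by blast
      have "{u, flip a u} \<in> H"
        using hv in_D pat unfolding h_def by (intro phase_closedD[OF cl a(1) v uv]) auto
      moreover have "{u, flip b u} \<in> H"
      proof (rule phase_closedD[OF cl b(1) w uv])
        fix j
        assume j: "j < n" "j \<noteq> b" "w ! j \<noteq> u ! j"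
        then have "v ! j \<noteq> w ! j" using in_D by blast
        then show "\<phi> w ! j = \<phi> u ! j"
          using pat[of j] other[of j] j by (cases "j = a") auto
      qed (use hb h_def in blast)
      ultimately show False using matching_unique[OF M uv a(1)] b(2) by blast
    qed
    from this[OF v w a agree] this[OF w v a(1) a(2)[symmetric] agree[symmetric]]
    show ?thesis by blast
  qed
  have "v = w" if v: "v \<in> vertices n" and w: "w \<in> vertices n"
    and agree: "\<forall>j<n. v ! j \<noteq> w ! j \<longrightarrow> reverse_edges n \<phi> H v ! j = reverse_edges n \<phi> H w ! j"
    for v w
  proof -
    have agree': "(\<phi> v ! j \<noteq> h v j) = (\<phi> w ! j \<noteq> h w j)" if "j < n" "v ! j \<noteq> w ! j" for j
      using agree that by (simp add: nth_reverse_edges h_def)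
    then have "\<phi> v ! j = \<phi> w ! j" if "j < n" "v ! j \<noteq> w ! j" for j
      using h_agree[OF v w that agree'] agree'[OF that] by blast
    then show ?thesis by (intro separatingD[OF sep v w]) blast
  qed
  then show ?thesis unfolding separating_def by blast
qed

lemma phase_closed_of_separating_reverse_edges:
  assumes sep: "separating n \<phi>" and M: "matching n H"
    and sep': "separating n (reverse_edges n \<phi> H)"
  shows "phase_closed n \<phi> H"
proof -
  define h where "h v j \<longleftrightarrow> {v, flip j v} \<in> H" for v j
  have h_unique: "i = j" if "h v i" "h v j" "v \<in> vertices n" "i < n" for v i j
    using that matching_unique[OF M] by (auto simp: h_def)
  have sep'': "v = w" if "v \<in> vertices n" "w \<in> vertices n"
    "\<And>j. j < n \<Longrightarrow> v ! j \<noteq> w ! j \<Longrightarrow> (\<phi> v ! j \<noteq> h v j) = (\<phi> w ! j \<noteq> h w j)" for v w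
    using that by (intro separatingD[OF sep']) (auto simp: nth_reverse_edges h_def)
  have "h w i"
    if "i < n" "v \<in> vertices n" "w \<in> vertices n"
      "\<forall>j<n. j \<noteq> i \<and> v ! j \<noteq> w ! j \<longrightarrow> \<phi> v ! j = \<phi> w ! j" "h v i" for i v w
    using that
  \<comment> \<open>Induction on the number of differing coordinates, with the dimension
    \<open>i\<close> left arbitrary since the hypothesis is used for another dimension
    \<open>b\<close>.\<close>
  proof (induction "card {j. j < n \<and> v ! j \<noteq> w ! j}" arbitrary: i v w rule: less_induct)
    case less
    let ?D = "{j. j < n \<and> v ! j \<noteq> w ! j}"
    note i = less.prems(1) and v = less.prems(2) and w = less.prems(3) and hv = less.prems(5)
    have agree: "\<phi> v ! j = \<phi> w ! j" if "j < n" "j \<noteq> i" "v ! j \<noteq> w ! j" for j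
      using less.prems(4) that by blast
    show ?case
    proof (rule ccontr)
      assume hw: "\<not> h w i"
      then have "v \<noteq> w" using hv by blast
      then have Di: "v ! i \<noteq> w ! i" "\<phi> v ! i \<noteq> \<phi> w ! i"
        using separatingD[OF sep v w] agree by metis+
      have not_hv: "\<not> h v j" if "j \<noteq> i" for j using h_unique[OF hv _ v i] that by blast
      obtain b where b: "b < n" "v ! b \<noteq> w ! b" "(\<phi> v ! b \<noteq> h v b) \<noteq> (\<phi> w ! b \<noteq> h w b)"
        using sep''[OF v w] \<open>v \<noteq> w\<close> by blast
      \<comment> \<open>At \<open>i\<close> both the original outmaps and membership in
        \<open>H\<close> differ, so the reversed outmaps agree.\<close>
      then have bi: "b \<noteq> i" using Di hv hw by blast
      then have hb: "h w b" using b agree not_hv by blast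
      obtain u where u: "u \<in> subcube n v ?D"
        and pat: "\<And>j. j \<in> ?D \<Longrightarrow> \<phi> u ! j \<longleftrightarrow> (\<phi> w ! j \<noteq> h w j)"
        using separating_surj[OF sep v, of ?D "\<lambda>j. \<phi> w ! j \<noteq> h w j"] by blast
      have uv: "u \<in> vertices n" using u by (simp add: subcube_def)
      have in_D: "v ! j \<noteq> w ! j" if "j < n" "v ! j \<noteq> u ! j \<or> w ! j \<noteq> u ! j" for j
        using u that by (auto simp: subcube_def)
      have not_hw: "\<not> h w j" if "j \<noteq> b" for j using h_unique[OF hb _ w b(1)] that by blast
      \<comment> \<open>At \<open>i\<close> the outmap of \<open>u\<close> equals that of
        \<open>w\<close>, not that of \<open>v\<close>. Hence \<open>u\<close> agrees with
        \<open>w\<close> somewhere in \<open>?D\<close>, which gives the smaller face.\<close>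
      have "u \<noteq> v" using pat[of i] hw Di i by blast
      then obtain c where c: "c < n" "u ! c \<noteq> v ! c" using vertices_eqI[OF uv v] by blast
      have "{j. j < n \<and> w ! j \<noteq> u ! j} \<subset> ?D"
        using in_D c by blast
      then have lt: "card {j. j < n \<and> w ! j \<noteq> u ! j} < card ?D"
        by (intro psubset_card_mono) auto
      \<comment> \<open>On the coordinates of \<open>?D\<close> other than \<open>b\<close>,
        reversal does not affect \<open>w\<close>, so \<open>u\<close> and \<open>w\<close> have
        equal outmaps there.\<close>
      have "h u b"
        using in_D pat not_hw
        by (intro less.hyps[OF lt b(1) w uv _ hb]) auto
      then have not_hu: "\<not> h u j" if "j \<noteq> b" for j
        using h_unique[of u b j] uv b(1) that by blast
      \<comment> \<open>At \<open>b\<close>, reversal at \<open>u\<close> undoes the change built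
        into its pattern; at \<open>i\<close>, reversal at \<open>v\<close> removes the discrepancy;
        elsewhere neither vertex is affected.\<close>
      have "u = v"
      proof (rule sep''[OF uv v])
        fix j
        assume j: "j < n" "u ! j \<noteq> v ! j"
        then have jD: "v ! j \<noteq> w ! j" using in_D by blast
        consider "j = b" | "j = i" | "j \<noteq> b" "j \<noteq> i" by blast
        then show "(\<phi> u ! j \<noteq> h u j) = (\<phi> v ! j \<noteq> h v j)"
        proof cases
          case 1
          then show ?thesis
            using pat[of j] j(1) jD \<open>h u b\<close> hb not_hv[OF bi] agree bi by auto
        next
          case 2
          then show ?thesis
            using pat[of j] j(1) jD not_hu hw hv Di bi by auto
        next
          case 3
          then show ?thesis
            using pat[of j] j(1) jD not_hu not_hw not_hv agree by auto
        qed
      qed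
      then show False using \<open>u \<noteq> v\<close> by blast
    qed
  qed
  then show ?thesis unfolding phase_closed_def h_def by blast
qed

theorem proposition20:
  fixes n :: nat and \<phi> :: "bool list \<Rightarrow> bool list" and H :: "bool list set set"
  assumes "uso n \<phi>"
    and "matching n H"
  shows "uso n (reverse_edges n \<phi> H) \<longleftrightarrow> (\<exists>\<P> \<subseteq> phases n \<phi>. H = \<Union>\<P>)"
proof -
  have "orientation n \<phi>" and sep: "separating n \<phi>"
    using assms(1) by (simp_all add: uso_iff_separating)
  then have "uso n (reverse_edges n \<phi> H) \<longleftrightarrow> separating n (reverse_edges n \<phi> H)"
    by (simp add: uso_iff_separating orientation_reverse_edges)
  also have "\<dots> \<longleftrightarrow> phase_closed n \<phi> H"
    using separating_reverse_edges phase_closed_of_separating_reverse_edges sep assms(2) by blast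
  also have "\<dots> \<longleftrightarrow> (\<exists>\<P> \<subseteq> phases n \<phi>. H = \<Union>\<P>)"
    using union_of_phases_iff_phase_closed assms(2) unfolding matching_def by blast
  finally show ?thesis .
qed

end
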